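(* For a path graph $G$ with $n$ nodes, the $k$-leader selection algorithm for path graphs (the specific procedure defined in the context: construct the digraph $\overline G$, then find a minimum-weight path from $s$ to $t$ with at most $k+1$ edges by the modified Bellman-Ford routine) identifies the leader set $S$, with $|S|\le k$, that minimizes $R(S)$, in $O(n^3)$ time.
   Context: **Problem.** $G=(V,E)$ is a path graph with $V=\{1,\dots,n\}$ numbered in order along the path. Each edge $(i,j)\in E$ has a noise parameter $\nu_{ij}=\nu_{ji}>0$ and edge weight $1/\nu_{ij}$. Let $\Delta_i=\sum_{j:(i,j)\in E}1/\nu_{ij}$. The weighted Laplacian $L$ has entries $L_{ij}=-1/\nu_{ij}$ if $(i,j)\in E$, $L_{ii}=\Delta_i$, and $0$ otherwise. For a nonempty leader set $S\subseteq V$, $L_{\mathit{ff}}$ is $L$ with the rows and columns of the nodes in $S$ removed (it is positive definite because $G$ is connected). The total steady-state variance of the leader-follower consensus system is $$R(S)=\sum_{i\in V\setminus S}r_i=\tfrac12\operatorname{tr}(L_{\mathit{ff}}^{-1}),$$ where $r_i=\tfrac12(L_{\mathit{ff}}^{-1})_{ii}$ is the steady-state variance of follower $i$. The trace for an empty matrix is $0$. The $k$-leader selection problem is to minimize $R(S)$ subject to $|S|\le k$. **The algorithm.** Input: $G$, the edge weights $1/\nu_{ij}$, and $k$. *Step 1 (digraph).* Form $L$ and construct the weighted digraph $\overline G=(\overline V,\overline E,W)$ with $\overline V=V\cup\{s,t\}$, where $s$ is a new source node and $t$ a new target node, and with the following edges: - $(s,v)$ for every $v\in V$, with weight $\operatorname{tr}(L_{[1,v)}^{-1})$,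 where $L_{[1,v)}$ is the submatrix of $L$ on rows and columns $1,\dots,v-1$; - $(u,v)$ for all $u,v\in V$ with $u<v$, with weight $\operatorname{tr}(L_{(u,v)}^{-1})$, where $L_{(u,v)}$ is the submatrix on rows and columns $u+1,\dots,v-1$; - $(v,t)$ for every $v\in V$, with weight $\operatorname{tr}(L_{(v,n]}^{-1})$, where $L_{(v,n]}$ is the submatrix on rows and columns $v+1,\dots,n$. The trace of the inverse of a submatrix of size $0$ is $0$. All these submatrices are tridiagonal, and the diagonal entries of each inverse are computed in $O(n)$ operations by a known method for tridiagonal matrices. *Step 2 (path).* Run the modified Bellman-Ford routine on $\overline G$ with source $s$, target $t$ and bound $H=k+1$, obtaining a path $P$ and its weight $w$. *Step 3 (output).* Let $S$ be the set of nodes of $P$ other than $s$ and $t$. Return $S$, together with $w$ as the error value. **Modified Bellman-Ford routine.** Input: a weighted digraph with edge weights $w(u,v)$, source $s$, target $t$, and a maximum number of edges $H$. Set $d_0(s)=0$ and $d_0(v)=\infty$ for $v\ne s$. For $m=1,\dots,H$ and every node $v$, set $d_m(v)=\min_u\{d_{m-1}(u)+w(u,v)\}$, the minimum being over nodes $u$ with an edge $(u,v)$ (and $\infty$ if there is none), and record a minimizing $u$ as the predecessor $\pi_m(v)$. Thus $d_m(v)$ is the minimum weight of a path from $s$ to $v$ with exactly $m$ edges. Then, among the computed paths from $s$ to $t$ with $m$ edges, $m=1,\dots,H$, take one of minimum weight, recover its nodes by following the predecessors back from $t$, and return it with its weight. Time is counted in elementary operations (arithmetic, comparisons, memory access), each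 of cost $O(1)$.
   Formalization: The O(n^3) time bound is stated for k ≤ n (for unbounded k the k+1 rounds of the Bellman-Ford routine alone exceed any multiple of n^3), and k ≥ 1 is assumed throughout since leader sets are nonempty. *)

theory Defs
  imports
    "HOL-Library.Extended_Real"
    "HOL-Library.Monad_Syntax"
    "Jordan_Normal_Form.DL_Submatrix"
    "Jordan_Normal_Form.Gauss_Jordan_Elimination"
begin

section \<open>The leader selection problem on a path graph\<close>

definition path_nodes :: "nat \<Rightarrow> nat set" where
  "path_nodes n = {1..n}"

definition path_edges :: "nat \<Rightarrow> (nat \<times> nat) set" where
  "path_edges n =
     {(i, j). i \<in> path_nodes n \<and> j \<in> path_nodes n \<and> (j = Suc i \<or> i = Suc j)}"

definition noise_params :: "nat \<Rightarrow> (nat \<Rightarrow> nat \<Rightarrow> real) \<Rightarrow> bool" where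
  "noise_params n \<nu> \<longleftrightarrow> (\<forall>(i, j) \<in> path_edges n. \<nu> i j = \<nu> j i \<and> \<nu> i j > 0)"

definition lap_entry :: "nat \<Rightarrow> (nat \<Rightarrow> nat \<Rightarrow> real) \<Rightarrow> nat \<Rightarrow> nat \<Rightarrow> real" where
  "lap_entry n \<nu> i j =
     (if (i, j) \<in> path_edges n then - (1 / \<nu> i j)
      else if i = j then (\<Sum>l | (i, l) \<in> path_edges n. 1 / \<nu> i l)
      else 0)"

text \<open>Matrix indices start at 0, so node \<open>Suc i\<close> owns row and column \<open>i\<close>.\<close>

definition laplacian :: "nat \<Rightarrow> (nat \<Rightarrow> nat \<Rightarrow> real) \<Rightarrow> real mat" where
  "laplacian n \<nu> = mat n n (\<lambda>(i, j). lap_entry n \<nu> (Suc i) (Suc j))"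

definition follower_laplacian :: "nat \<Rightarrow> (nat \<Rightarrow> nat \<Rightarrow> real) \<Rightarrow> nat set \<Rightarrow> real mat" where
  "follower_laplacian n \<nu> S =
     (let F = {i. Suc i \<in> path_nodes n - S} in submatrix (laplacian n \<nu>) F F)"

definition mat_trace :: "real mat \<Rightarrow> real" where
  "mat_trace A = (\<Sum>i<dim_row A. A $$ (i, i))"

text \<open>
  Only meaningful for nonempty \<open>S\<close>: the follower Laplacian is then nonsingular, so
  \<^const>\<open>mat_inverse\<close> yields \<^const>\<open>Some\<close> inverse.
\<close>

definition total_variance :: "nat \<Rightarrow> (nat \<Rightarrow> nat \<Rightarrow> real) \<Rightarrow> nat set \<Rightarrow> real" where
  "total_variance n \<nu> S = 1 / 2 * mat_trace (the (mat_inverse (follower_laplacian n \<nu> S)))"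

section \<open>Computations that count elementary operations\<close>

datatype 'a tm = TM (val: 'a) (time: nat)

definition bind_tm :: "'a tm \<Rightarrow> ('a \<Rightarrow> 'b tm) \<Rightarrow> 'b tm" where
  "bind_tm m f = TM (val (f (val m))) (time m + time (f (val m)))"

adhoc_overloading Monad_Syntax.bind \<rightleftharpoons> bind_tm

text \<open>
  The programs below touch data only through the following unit-cost operations (and through
  \<open>alloc\<close>, which pays for every cell it initialises); binding variables, branching on an already
  computed Boolean and forming tuples are free.  Arrays are modelled as total functions and are
  always used single-threaded, so that a write stands for an update in place.
\<close>

definition return :: "'a \<Rightarrow> 'a tm" where "return x = TM x 0"
definition tick :: "unit tm" where "tick = TM () 1"

definition add :: "'a::plus \<Rightarrow> 'a \<Rightarrow> 'a tm" where "add x y = TM (x + y) 1"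
definition sub :: "'a::minus \<Rightarrow> 'a \<Rightarrow> 'a tm" where "sub x y = TM (x - y) 1"
definition mul :: "'a::times \<Rightarrow> 'a \<Rightarrow> 'a tm" where "mul x y = TM (x * y) 1"
definition quot :: "real \<Rightarrow> real \<Rightarrow> real tm" where "quot x y = TM (x / y) 1"
definition neg :: "real \<Rightarrow> real tm" where "neg x = TM (- x) 1"

definition test_less :: "'a::ord \<Rightarrow> 'a \<Rightarrow> bool tm" where "test_less x y = TM (x < y) 1"
definition test_eq :: "'a \<Rightarrow> 'a \<Rightarrow> bool tm" where "test_eq x y = TM (x = y) 1"

definition alloc :: "nat \<Rightarrow> 'a \<Rightarrow> ('i \<Rightarrow> 'a) tm" where
  "alloc cells x = TM (\<lambda>_. x) (Suc cells)"
definition rd :: "('i \<Rightarrow> 'a) \<Rightarrow> 'i \<Rightarrow> 'a tm" where "rd a i = TM (a i) 1"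
definition wr :: "('i \<Rightarrow> 'a) \<Rightarrow> 'i \<Rightarrow> 'a \<Rightarrow> ('i \<Rightarrow> 'a) tm" where
  "wr a i x = TM (a(i := x)) 1"
definition cons :: "'a \<Rightarrow> 'a list \<Rightarrow> 'a list tm" where "cons x xs = TM (x # xs) 1"

text \<open>
  A loop pays two operations per round (exit test, advance) and one for the final exit test.
  The list is either an actual list or a counter range \<open>[a..<b]\<close>, possibly reversed, whose
  bounds have been computed before.
\<close>

fun for_each :: "'i list \<Rightarrow> ('i \<Rightarrow> 's \<Rightarrow> 's tm) \<Rightarrow> 's \<Rightarrow> 's tm" where
  "for_each [] body s = do { tick; return s }"
| "for_each (i # is) body s = do { tick; tick; s' \<leftarrow> body i s; for_each is body s' }"

section \<open>The algorithm\<close>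

text \<open>The array \<open>g\<close> holds the edge weights; the resulting array is indexed by the nodes 1 to n.\<close>

definition form_laplacian :: "nat \<Rightarrow> (nat \<times> nat \<Rightarrow> real) \<Rightarrow> (nat \<times> nat \<Rightarrow> real) tm" where
  "form_laplacian n g = do {
     n1 \<leftarrow> add n 1;
     c \<leftarrow> mul n1 n1;
     A \<leftarrow> alloc c 0;
     for_each [1..<n] (\<lambda>i A. do {
       j \<leftarrow> add i 1;
       w \<leftarrow> rd g (i, j);
       w' \<leftarrow> neg w;
       A \<leftarrow> wr A (i, j) w';
       A \<leftarrow> wr A (j, i) w';
       x \<leftarrow> rd A (i, i);
       x' \<leftarrow> add x w;
       A \<leftarrow> wr A (i, i) x';
       y \<leftarrow> rd A (j, j);
       y' \<leftarrow> add y w;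
       wr A (j, j) y'
     }) A
   }"

text \<open>
  The trace of the inverse of the tridiagonal submatrix \<open>T\<close> of \<open>A\<close> on the rows and columns
  \<open>lo, \<dots>, hi - 1\<close>, by the standard recurrences for the leading minors
  \<open>\<theta> i = det T[lo..<i]\<close> and the trailing minors \<open>\<phi> i = det T[i..<hi]\<close>:
  the diagonal entry of the inverse at row \<open>i\<close> is \<open>\<theta> i * \<phi> (i + 1) / \<theta> hi\<close>.
\<close>

definition trace_inv_tridiag :: "(nat \<times> nat \<Rightarrow> real) \<Rightarrow> nat \<Rightarrow> nat \<Rightarrow> real tm" where
  "trace_inv_tridiag A lo hi = do {
     nonempty \<leftarrow> test_less lo hi;
     if \<not> nonempty then return 0 else do {
       h1 \<leftarrow> sub hi 1;
       l1 \<leftarrow> add lo 1;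
       c \<leftarrow> add hi 1;
       \<theta> \<leftarrow> alloc c 0;
       \<theta> \<leftarrow> wr \<theta> lo 1;
       x \<leftarrow> rd A (lo, lo);
       \<theta> \<leftarrow> wr \<theta> l1 x;
       \<theta> \<leftarrow> for_each [l1..<hi] (\<lambda>i \<theta>. do {
         p \<leftarrow> sub i 1;
         q \<leftarrow> add i 1;
         a \<leftarrow> rd A (i, i);
         b \<leftarrow> rd A (p, i);
         b' \<leftarrow> rd A (i, p);
         t \<leftarrow> rd \<theta> i;
         t' \<leftarrow> rd \<theta> p;
         y \<leftarrow> mul a t;
         z \<leftarrow> mul b b';
         z' \<leftarrow> mul z t';
         r \<leftarrow> sub y z';
         wr \<theta> q r
       }) \<theta>;
       \<phi> \<leftarrow> alloc c 0;
       \<phi> \<leftarrow> wr \<phi> hi 1;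
       x \<leftarrow> rd A (h1, h1);
       \<phi> \<leftarrow> wr \<phi> h1 x;
       \<phi> \<leftarrow> for_each (rev [lo..<h1]) (\<lambda>i \<phi>. do {
         q \<leftarrow> add i 1;
         q' \<leftarrow> add i 2;
         a \<leftarrow> rd A (i, i);
         b \<leftarrow> rd A (i, q);
         b' \<leftarrow> rd A (q, i);
         t \<leftarrow> rd \<phi> q;
         t' \<leftarrow> rd \<phi> q';
         y \<leftarrow> mul a t;
         z \<leftarrow> mul b b';
         z' \<leftarrow> mul z t';
         r \<leftarrow> sub y z';
         wr \<phi> i r
       }) \<phi>;
       D \<leftarrow> rd \<theta> hi;
       for_each [lo..<hi] (\<lambda>i tr. do {
         q \<leftarrow> add i 1;
         t \<leftarrow> rd \<theta> i;
         f \<leftarrow> rd \<phi> q;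
         y \<leftarrow> mul t f;
         e \<leftarrow> quot y D;
         add tr e
       }) 0
     }
   }"

text \<open>
  The digraph has the nodes \<open>0, \<dots>, n + 1\<close>, where 0 is the source \<open>s\<close> and \<open>n + 1\<close> is the
  target \<open>t\<close>.  It is stored as an adjacency matrix: \<^const>\<open>None\<close> means that there is no edge,
  \<open>Some w\<close> is an edge of weight \<open>w\<close>.
\<close>

definition build_digraph ::
    "nat \<Rightarrow> (nat \<times> nat \<Rightarrow> real) \<Rightarrow> nat \<Rightarrow> nat \<Rightarrow> (nat \<times> nat \<Rightarrow> real option) tm" where
  "build_digraph n g s t = do {
     A \<leftarrow> form_laplacian n g;
     n1 \<leftarrow> add n 1;
     n2 \<leftarrow> add n 2;
     c \<leftarrow> mul n2 n2;
     W \<leftarrow> alloc c None;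
     W \<leftarrow> for_each [1..<n1] (\<lambda>v W. do {
       w \<leftarrow> trace_inv_tridiag A 1 v;
       wr W (s, v) (Some w)
     }) W;
     W \<leftarrow> for_each [1..<n1] (\<lambda>u W. do {
       u1 \<leftarrow> add u 1;
       for_each [u1..<n1] (\<lambda>v W. do {
         w \<leftarrow> trace_inv_tridiag A u1 v;
         wr W (u, v) (Some w)
       }) W
     }) W;
     for_each [1..<n1] (\<lambda>v W. do {
       v1 \<leftarrow> add v 1;
       w \<leftarrow> trace_inv_tridiag A v1 n1;
       wr W (v, t) (Some w)
     }) W
   }"

text \<open>
  Should a candidate replace the incumbent?  On equality \<open>tie\<close> decides, so that every choice of
  a minimizer can arise.
\<close>

definition improves :: "bool \<Rightarrow> ereal \<Rightarrow> ereal \<Rightarrow> bool tm" where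
  "improves tie x best = do {
     b \<leftarrow> test_less x best;
     if b then return True else do {
       e \<leftarrow> test_eq x best;
       return (e \<and> tie)
     }
   }"

text \<open>
  \<open>W\<close> is the adjacency matrix of a digraph on the nodes \<open>{..<N}\<close>; \<open>d (m, v)\<close> and \<open>p (m, v)\<close>
  are \<open>d\<^sub>m(v)\<close> and its recorded predecessor.  The parameters \<open>tie_pred\<close> and \<open>tie_len\<close> resolve ties in
  the choice of the predecessors and of the final number of edges.
\<close>

definition bellman_ford ::
    "(nat \<Rightarrow> nat \<Rightarrow> nat \<Rightarrow> bool) \<Rightarrow> (nat \<Rightarrow> bool) \<Rightarrow> nat \<Rightarrow> (nat \<times> nat \<Rightarrow> real option)
       \<Rightarrow> nat \<Rightarrow> nat \<Rightarrow> nat \<Rightarrow> (nat list \<times> ereal) tm" where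
  "bellman_ford tie_pred tie_len N W s t H = do {
     H1 \<leftarrow> add H 1;
     c \<leftarrow> mul H1 N;
     d \<leftarrow> alloc c \<infinity>;
     d \<leftarrow> wr d (0, s) 0;
     p \<leftarrow> alloc c s;
     (d, p) \<leftarrow> for_each [1..<H1] (\<lambda>m (d, p). do {
       m' \<leftarrow> sub m 1;
       for_each [0..<N] (\<lambda>v (d, p). do {
         (best, pred) \<leftarrow> for_each [0..<N] (\<lambda>u (best, pred). do {
           e \<leftarrow> rd W (u, v);
           tick;
           case e of
             None \<Rightarrow> return (best, pred)
           | Some w \<Rightarrow> do {
               x \<leftarrow> rd d (m', u);
               y \<leftarrow> add x (ereal w);
               b \<leftarrow> improves (tie_pred m v u) y best;
               return (if b then (y, u) else (best, pred))
             }
         }) (\<infinity>, s);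
         d \<leftarrow> wr d (m, v) best;
         p \<leftarrow> wr p (m, v) pred;
         return (d, p)
       }) (d, p)
     }) (d, p);
     (w, M) \<leftarrow> for_each [1..<H1] (\<lambda>m (best, M). do {
       x \<leftarrow> rd d (m, t);
       b \<leftarrow> improves (tie_len m) x best;
       return (if b then (x, m) else (best, M))
     }) (\<infinity>, 0);
     M1 \<leftarrow> add M 1;
     P \<leftarrow> cons t [];
     (P, _) \<leftarrow> for_each (rev [1..<M1]) (\<lambda>m (P, v). do {
       u \<leftarrow> rd p (m, v);
       P \<leftarrow> cons u P;
       return (P, u)
     }) (P, t);
     return (P, w)
   }"

definition select_leaders ::
    "(nat \<Rightarrow> nat \<Rightarrow> nat \<Rightarrow> bool) \<Rightarrow> (nat \<Rightarrow> bool) \<Rightarrow> nat \<Rightarrow> (nat \<times> nat \<Rightarrow> real) \<Rightarrow> nat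
       \<Rightarrow> (nat list \<times> ereal) tm" where
  "select_leaders tie_pred tie_len n g k = do {
     let s = 0;
     t \<leftarrow> add n 1;
     N \<leftarrow> add n 2;
     H \<leftarrow> add k 1;
     W \<leftarrow> build_digraph n g s t;
     (P, w) \<leftarrow> bellman_ford tie_pred tie_len N W s t H;
     S \<leftarrow> for_each P (\<lambda>v S. do {
       a \<leftarrow> test_eq v s;
       b \<leftarrow> test_eq v t;
       if a \<or> b then return S else cons v S
     }) [];
     return (S, w)
   }"

end

theory Submission
  imports Defs "Jordan_Normal_Form.Determinant"
begin

text \<open>
  Removing the leaders splits the Laplacian into tridiagonal blocks, one for each maximal interval of
  followers.  Unless the interval is the whole path, the block has a positive determinant, and its
  inverse is an explicit Green matrix; so \<open>2 R(S)\<close> is a sum of contributions of consecutive leaders,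
  that is, the weight of the path of the digraph through \<open>S\<close>.  Since edges of the digraph increase
  the node number, the paths from source to target with \<open>m\<close> edges are exactly the sets of
  \<open>m - 1\<close> leaders, so a shortest path with at most \<open>k + 1\<close> edges is an optimal leader set.
\<close>

section \<open>Inverting the follower Laplacian\<close>

text \<open>The source \<open>0\<close> and the target \<open>n + 1\<close> act as leaders attached
  to the path by edges of weight 0. An end node then has the same kind of Laplacian row as an inner
  node, and the first and last gaps need no formula of their own. The price is that products of edge
  weights may vanish. Hence minors are kept free of division: \<open>esum\<close> is the elementary
  symmetric polynomial of degree one below the number of edges. A block reaching one end contains
  one zero, and only the summand omitting it survives; the whole path contains two, and its minor
  vanishes. That is the singular Laplacian without leaders, and the reason why no edge joins source
  and target.

  The inverse is not derived but written down and verified entrywise; this rests on three-term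
  recurrences for minors, the same ones that the program evaluates. The cost is defined for the
  leaders below a node \<open>v\<close>, with \<open>v\<close> closing the last gap, because this
  prefix form is additive along edges. The specification of the shortest-path routine says that
  minima are attained but not which minimizer is recorded, so all resolutions of ties are covered at
  once.\<close>

definition esum :: "(nat \<Rightarrow> real) \<Rightarrow> nat set \<Rightarrow> real" where
  "esum g E = (\<Sum>m\<in>E. \<Prod>l\<in>E - {m}. g l)"

lemma esum_empty [simp]: "esum g {} = 0"
  by (simp add: esum_def)

lemma esum_insert:
  assumes "finite E" "x \<notin> E"
  shows "esum g (insert x E) = g x * esum g E + prod g E"
proof -
  have "(\<Prod>l\<in>insert x E - {m}. g l) = g x * (\<Prod>l\<in>E - {m}. g l)" if "m \<in> E" for m
    using assms that by (subst insert_Diff_if) auto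
  then show ?thesis
    using assms by (simp add: esum_def sum_distrib_left)
qed

text \<open>The omitted index lies in one of the two parts; the other part then contributes its full
  product.\<close>

lemma esum_Un:
  assumes "finite A" "finite B" "A \<inter> B = {}"
  shows "esum g (A \<union> B) = esum g A * prod g B + esum g B * prod g A"
  using assms
proof (induction A rule: finite_induct)
  case (insert x A)
  then show ?case
    by (simp add: esum_insert prod.union_disjoint algebra_simps)
qed simp

text \<open>\<open>g\<close> may vanish at \<open>m\<close>, as it does at an end of the path: the
  summand omitting \<open>m\<close> is positive and the others are nonnegative.\<close>

lemma esum_pos:
  assumes "finite E" "m \<in> E" "\<And>l. l \<in> E \<Longrightarrow> g l \<ge> 0" "\<And>l. l \<in> E - {m} \<Longrightarrow> g l > 0"
  shows "esum g E > 0"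
proof -
  have "0 < (\<Prod>l\<in>E - {m}. g l)"
    using assms by (intro prod_pos) auto
  also have "\<dots> \<le> esum g E"
    unfolding esum_def using assms
    by (intro member_le_sum[of m E "\<lambda>m. \<Prod>l\<in>E - {m}. g l"]) (auto intro!: prod_nonneg)
  finally show ?thesis .
qed

text \<open>
  With \<open>g l\<close> the weight of the edge from \<open>l\<close> to \<open>l + 1\<close> (and \<open>g 0 = g n = 0\<close>),
  \<open>minor g lo hi\<close> is the determinant of the block of the Laplacian on the rows \<open>lo, \<dots>, hi - 1\<close>:
  by the matrix-tree theorem it sums, over the omitted edge, the products of the remaining edges
  among \<open>lo - 1, \<dots>, hi - 1\<close>.  Both families of minors in \<^const>\<open>trace_inv_tridiag\<close> are of this form.
\<close>

definition minor :: "(nat \<Rightarrow> real) \<Rightarrow> nat \<Rightarrow> nat \<Rightarrow> real" where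
  "minor g lo hi = esum g {lo - 1..<hi}"

lemma minor_self: "lo \<ge> 1 \<Longrightarrow> minor g lo lo = 1"
proof -
  assume "lo \<ge> 1"
  then have "{lo - 1..<lo} = {lo - 1}" by auto
  then show ?thesis by (simp add: minor_def esum_def)
qed

lemma minor_Suc:
  "lo \<le> Suc i \<Longrightarrow> minor g lo (Suc i) = g i * minor g lo i + prod g {lo - 1..<i}"
  using atLeastLessThanSuc[of "lo - 1" i]
  by (auto simp: minor_def esum_insert)

lemma minor_left:
  assumes "1 \<le> i" "i \<le> hi"
  shows "minor g i hi = g (i - 1) * minor g (Suc i) hi + prod g {i..<hi}"
proof -
  have "{i - 1..<hi} = insert (i - 1) {i..<hi}" using assms by auto
  then show ?thesis using assms by (auto simp: minor_def esum_insert)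
qed

text \<open>Two instances of \<open>minor_Suc\<close>, between which the product of links is
  eliminated. At \<open>i = lo\<close> the last minor is an empty sum, so the recurrence already
  holds at its first step.\<close>

lemma minor_rec_right:
  assumes "1 \<le> lo" "lo \<le> i"
  shows "minor g lo (Suc i) = (g (i - 1) + g i) * minor g lo i - g (i - 1) * g (i - 1) * minor g lo (i - 1)"
proof -
  have i: "Suc (i - 1) = i" using assms by simp
  have "{lo - 1..<i} = insert (i - 1) {lo - 1..<i - 1}" using assms by auto
  then have "prod g {lo - 1..<i} = g (i - 1) * prod g {lo - 1..<i - 1}" by simp
  then show ?thesis
    using minor_Suc[of lo i g] minor_Suc[of lo "i - 1" g] assms i
    by (simp add: algebra_simps)
qed

lemma minor_rec_left:
  assumes "1 \<le> i" "i < hi"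
  shows "minor g i hi = (g (i - 1) + g i) * minor g (Suc i) hi - g i * g i * minor g (Suc (Suc i)) hi"
proof -
  have "{i..<hi} = insert i {Suc i..<hi}" using assms by auto
  then have "prod g {i..<hi} = g i * prod g {Suc i..<hi}" by simp
  then show ?thesis
    using minor_left[of i hi g] minor_left[of "Suc i" hi g] assms
    by (simp add: algebra_simps)
qed

text \<open>The source of the unit diagonal entry in \<open>green_column\<close>.\<close>

lemma minor_split:
  assumes "1 \<le> lo" "lo \<le> i" "i < hi"
  shows "minor g lo (Suc i) * minor g (Suc i) hi - g i * g i * minor g lo i * minor g (Suc (Suc i)) hi
         = minor g lo hi"
proof -
  let ?A = "{lo - 1..<i}" and ?B = "{Suc i..<hi}"
  have eqs: "{lo - 1..<Suc i} = insert i ?A" "{i..<hi} = insert i ?B"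
    "{lo - 1..<hi} = insert i (?A \<union> ?B)"
    using assms by auto
  have dj: "?A \<inter> ?B = {}" by auto
  have "minor g lo (Suc i) = g i * esum g ?A + prod g ?A"
    "minor g (Suc i) hi = g i * esum g ?B + prod g ?B"
    "minor g lo hi = g i * esum g (?A \<union> ?B) + prod g (?A \<union> ?B)"
    using eqs by (auto simp: minor_def esum_insert)
  moreover have "minor g lo i = esum g ?A" "minor g (Suc (Suc i)) hi = esum g ?B"
    by (auto simp: minor_def)
  moreover have "prod g (?A \<union> ?B) = prod g ?A * prod g ?B"
    using dj by (intro prod.union_disjoint) auto
  ultimately show ?thesis
    using esum_Un[of ?A ?B g] dj by (simp add: algebra_simps)
qed

text \<open>The entries of the inverse of the block on the rows \<open>lo, \<dots>, hi - 1\<close>.\<close>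

definition green :: "(nat \<Rightarrow> real) \<Rightarrow> nat \<Rightarrow> nat \<Rightarrow> nat \<Rightarrow> nat \<Rightarrow> real" where
  "green g lo hi i j =
     (if i \<le> j then prod g {i..<j} * minor g lo i * minor g (Suc j) hi / minor g lo hi
      else prod g {j..<i} * minor g lo j * minor g (Suc i) hi / minor g lo hi)"

text \<open>Just outside the block \<open>minor\<close> is an empty sum, so the boundary rows need no special treatment.\<close>

lemma green_boundary:
  assumes "1 \<le> lo" "lo \<le> j" "j < hi"
  shows "green g lo hi (lo - 1) j = 0" "green g lo hi hi j = 0"
  using assms by (auto simp: green_def minor_def)

text \<open>On each side of the diagonal the three entries share a factor \<open>?C\<close>, and
  what remains is a recurrence for minors. On the diagonal the two one-sided solutions meet, and
  \<open>minor_split\<close> plays the part of a constant Wronskian.\<close>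

lemma green_column:
  assumes "1 \<le> lo" "lo \<le> j" "j < hi" "lo \<le> i" "i < hi" and nz: "minor g lo hi \<noteq> 0"
  shows "(g (i - 1) + g i) * green g lo hi i j - g (i - 1) * green g lo hi (i - 1) j
           - g i * green g lo hi (Suc i) j = of_bool (i = j)"
proof -
  consider "i < j" | "i = j" | "i > j" by linarith
  then show ?thesis
  proof cases
    case 1
    let ?C = "prod g {i..<j} * minor g (Suc j) hi / minor g lo hi"
    have p1: "prod g {i..<j} = g i * prod g {Suc i..<j}"
      using 1 by (simp add: prod.atLeast_Suc_lessThan)
    have "{i - 1..<j} = insert (i - 1) {i..<j}" using 1 assms by auto
    then have p2: "prod g {i - 1..<j} = g (i - 1) * prod g {i..<j}"
      using assms by simp
    have e: "green g lo hi i j = minor g lo i * ?C"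
      "green g lo hi (i - 1) j = g (i - 1) * minor g lo (i - 1) * ?C"
      "g i * green g lo hi (Suc i) j = minor g lo (Suc i) * ?C"
      using 1 p1 p2 by (auto simp: green_def)
    have "(g (i - 1) + g i) * green g lo hi i j - g (i - 1) * green g lo hi (i - 1) j
           - g i * green g lo hi (Suc i) j
        = ?C * ((g (i - 1) + g i) * minor g lo i - g (i - 1) * g (i - 1) * minor g lo (i - 1)
           - minor g lo (Suc i))"
      unfolding e by (simp only: algebra_simps)
    then show ?thesis
      using 1 minor_rec_right[OF assms(1,4), of g] by simp
  next
    case 2
    have "{i - 1..<i} = {i - 1}" using assms by auto
    then have p: "prod g {i - 1..<i} = g (i - 1)" by simp
    have "(g (i - 1) + g i) * green g lo hi i j - g (i - 1) * green g lo hi (i - 1) j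
           - g i * green g lo hi (Suc i) j
        = (((g (i - 1) + g i) * minor g lo i - g (i - 1) * g (i - 1) * minor g lo (i - 1))
              * minor g (Suc i) hi
           - g i * g i * minor g lo i * minor g (Suc (Suc i)) hi) / minor g lo hi"
      using 2 assms p by (simp add: green_def field_simps)
    also have "\<dots> = 1"
      using minor_rec_right[OF assms(1,4), of g] minor_split[OF assms(1,4,5), of g] nz by simp
    finally show ?thesis using 2 by simp
  next
    case 3
    let ?C = "prod g {j..<i} * minor g lo j / minor g lo hi"
    have "{j..<i} = insert (i - 1) {j..<i - 1}" using 3 by auto
    then have p1: "prod g {j..<i} = g (i - 1) * prod g {j..<i - 1}" by simp
    have p2: "prod g {j..<Suc i} = g i * prod g {j..<i}"
      using 3 by (simp add: mult.commute)
    have e: "green g lo hi i j = minor g (Suc i) hi * ?C"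
      "green g lo hi (Suc i) j = g i * minor g (Suc (Suc i)) hi * ?C"
      using 3 by (auto simp: green_def p2)
    \<comment> \<open>For \<open>i - 1 = j\<close> the upper neighbour is the diagonal entry, which
      falls under the other branch of \<open>green\<close>.\<close>
    have e': "g (i - 1) * green g lo hi (i - 1) j = minor g i hi * ?C"
    proof (cases "i - 1 = j")
      case True
      then have "Suc j = i" using 3 by simp
      then show ?thesis using True p1 by (simp add: green_def)
    qed (use 3 p1 in \<open>auto simp: green_def\<close>)
    have "(g (i - 1) + g i) * green g lo hi i j - g (i - 1) * green g lo hi (i - 1) j
           - g i * green g lo hi (Suc i) j
        = ?C * ((g (i - 1) + g i) * minor g (Suc i) hi - minor g i hi
           - g i * g i * minor g (Suc (Suc i)) hi)"
      unfolding e e' by (simp only: algebra_simps)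
    then show ?thesis
      using 3 minor_rec_left[of i hi g] assms by simp
  qed
qed

definition block_trace :: "(nat \<Rightarrow> real) \<Rightarrow> nat \<Rightarrow> nat \<Rightarrow> real" where
  "block_trace g lo hi = (\<Sum>i = lo..<hi. green g lo hi i i)"

section \<open>The Laplacian in terms of edge weights\<close>

definition link :: "nat \<Rightarrow> (nat \<Rightarrow> nat \<Rightarrow> real) \<Rightarrow> nat \<Rightarrow> real" where
  "link n \<nu> l = (if 1 \<le> l \<and> l < n then 1 / \<nu> l (Suc l) else 0)"

lemma noise_pos: "noise_params n \<nu> \<Longrightarrow> 1 \<le> l \<Longrightarrow> l < n \<Longrightarrow> \<nu> l (Suc l) > 0 \<and> \<nu> (Suc l) l = \<nu> l (Suc l)"
  by (force simp: noise_params_def path_edges_def path_nodes_def)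

lemma lap_entry_link:
  assumes "noise_params n \<nu>" "i \<in> {1..n}" "j \<in> {1..n}"
  shows "lap_entry n \<nu> i j =
    (if i = j then link n \<nu> (i - 1) + link n \<nu> i
     else if j = Suc i then - link n \<nu> i else if i = Suc j then - link n \<nu> j else 0)"
proof (cases "i = j")
  case True
  have "{l. (i, l) \<in> path_edges n} = (if 1 < i then {i - 1} else {}) \<union> (if i < n then {Suc i} else {})"
    using assms by (auto simp: path_edges_def path_nodes_def)
  then have "(\<Sum>l | (i, l) \<in> path_edges n. 1 / \<nu> i l) = link n \<nu> (i - 1) + link n \<nu> i"
    using assms noise_pos[OF assms(1), of "i - 1"] by (auto simp: link_def)
  then show ?thesis using True by (auto simp: lap_entry_def path_edges_def)
next
  case False
  then show ?thesis
    using assms noise_pos[OF assms(1), of j]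
    by (auto simp: lap_entry_def path_edges_def path_nodes_def link_def)
qed

text \<open>Only the links \<open>0\<close> and \<open>n\<close> vanish, and at most one of them
  lies in \<open>{lo - 1..<hi}\<close>. The omitted index is chosen so as to remove it:
  \<open>0\<close> if \<open>lo = 1\<close>, and otherwise \<open>hi - 1\<close>, which equals
  \<open>n\<close> when \<open>hi = Suc n\<close>.\<close>

lemma minor_link_pos:
  assumes "noise_params n \<nu>" "1 \<le> lo" "lo \<le> hi" "hi \<le> Suc n" "\<not> (lo = 1 \<and> hi = Suc n)"
  shows "minor (link n \<nu>) lo hi > 0"
  unfolding minor_def
  by (rule esum_pos[where m = "if lo = 1 then 0 else hi - 1"])
    (use assms noise_pos[OF assms(1)] in \<open>auto simp: link_def less_imp_le split: if_splits\<close>)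

section \<open>From an entrywise inverse to the total variance\<close>

lemma bij_betw_pick: "finite S \<Longrightarrow> bij_betw (pick S) {..<card S} S"
proof -
  assume fin: "finite S"
  have inj: "inj_on (pick S) {..<card S}"
    by (rule linorder_inj_onI') (metis lessThan_iff less_irrefl pick_mono_le)
  have "pick S ` {..<card S} \<subseteq> S" using pick_in_set_le by auto
  then have "pick S ` {..<card S} = S"
    using fin inj by (intro card_subset_eq) (auto simp: card_image)
  then show ?thesis using inj by (simp add: bij_betw_def)
qed

text \<open>A right inverse of a square matrix over a field is two-sided; so \<open>A\<close> is a
  unit, \<open>mat_inverse\<close> succeeds on it, and inverses are unique.\<close>

lemma mat_inverse_eqI:
  fixes A :: "'a :: field mat"
  assumes A: "A \<in> carrier_mat c c" and B: "B \<in> carrier_mat c c" and AB: "A * B = 1\<^sub>m c"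
  shows "mat_inverse A = Some B"
proof -
  have BA: "B * A = 1\<^sub>m c" using mat_mult_left_right_inverse[OF A B AB] .
  then have "A \<in> Units (ring_mat TYPE('a) c ())"
    using A B AB by (auto simp: Units_def ring_mat_simps)
  then obtain C where C: "mat_inverse A = Some C"
    using mat_inverse(1)[OF A, where b = "()"] by (cases "mat_inverse A") auto
  then have AC: "A * C = 1\<^sub>m c" and Cc: "C \<in> carrier_mat c c" using mat_inverse(2)[OF A] by auto
  have "C = B * A * C" using BA Cc by simp
  also have "\<dots> = B * (A * C)" using A B Cc by simp
  also have "\<dots> = B" using AC B by simp
  finally have "C = B" .
  with C show ?thesis by simp
qed

text \<open>The submatrix renumbers its rows from 0; \<open>r\<close> sends row \<open>a\<close>
  back to its node. Candidates for the inverse can thus be indexed by nodes throughout.\<close>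

lemma total_variance_eqI:
  assumes inv: "\<And>i j. i \<in> {1..n} - S \<Longrightarrow> j \<in> {1..n} - S \<Longrightarrow>
      (\<Sum>l\<in>{1..n} - S. lap_entry n \<nu> i l * G l j) = of_bool (i = j)"
  shows "total_variance n \<nu> S = 1 / 2 * (\<Sum>i\<in>{1..n} - S. G i i)"
proof -
  let ?F = "{1..n} - S"
  define I where "I = {i. Suc i \<in> ?F}"
  have I: "I \<subseteq> {..<n}" "Suc ` I = ?F"
    by (auto simp: I_def image_iff) (metis Suc_pred' Suc_le_D not_less_eq_eq One_nat_def Suc_le_lessD)
  then have fin: "finite I" using finite_subset by blast
  define c where "c = card I"
  define r where "r = (\<lambda>a. Suc (pick I a))"
  have bij: "bij_betw r {..<c} ?F"
    using bij_betw_trans[OF bij_betw_pick[OF fin], of Suc ?F] I(2)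
    by (simp add: r_def c_def o_def bij_betw_def)
  have rF: "r a \<in> ?F" if "a < c" for a
    using bij that by (auto simp: bij_betw_def)
  have r_eq: "r a = r b \<longleftrightarrow> a = b" if "a < c" "b < c" for a b
    using bij that by (auto simp: bij_betw_def inj_on_def)
  let ?L = "follower_laplacian n \<nu> S"
  let ?G = "mat c c (\<lambda>(a, b). G (r a) (r b))"
  have "{i. i < n \<and> i \<in> I} = I" using I by auto
  moreover have "{i. Suc i \<in> path_nodes n - S} = I" by (simp add: I_def path_nodes_def)
  moreover have "pick I a < n" if "a < c" for a
    using rF[OF that] by (simp add: r_def)
  ultimately have L: "?L = mat c c (\<lambda>(a, b). lap_entry n \<nu> (r a) (r b))"
    by (auto simp: follower_laplacian_def submatrix_def laplacian_def Let_def c_def r_def intro!: eq_matI)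
  then have Lc: "?L \<in> carrier_mat c c" by simp
  have LG: "?L * ?G = 1\<^sub>m c"
  proof (rule eq_matI)
    fix a b assume "a < dim_row (1\<^sub>m c)" "b < dim_col (1\<^sub>m c)"
    then have ab: "a < c" "b < c" by auto
    then have "(?L * ?G) $$ (a, b) = (\<Sum>e<c. lap_entry n \<nu> (r a) (r e) * G (r e) (r b))"
      by (simp add: L scalar_prod_def lessThan_atLeast0)
    also have "\<dots> = (\<Sum>l\<in>?F. lap_entry n \<nu> (r a) l * G l (r b))"
      by (rule sum.reindex_bij_betw[OF bij])
    also have "\<dots> = of_bool (r a = r b)" using ab rF by (intro inv) auto
    finally show "(?L * ?G) $$ (a, b) = 1\<^sub>m c $$ (a, b)"
      using ab r_eq by auto
  qed (auto simp: L)
  have "mat_inverse ?L = Some ?G"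
    by (rule mat_inverse_eqI[OF Lc _ LG]) simp
  then have "total_variance n \<nu> S = 1 / 2 * (\<Sum>a<c. G (r a) (r a))"
    by (simp add: total_variance_def mat_trace_def)
  also have "(\<Sum>a<c. G (r a) (r a)) = (\<Sum>i\<in>?F. G i i)"
    by (rule sum.reindex_bij_betw[OF bij])
  finally show ?thesis .
qed

section \<open>The variance as a sum over gaps between leaders\<close>

definition prev :: "nat set \<Rightarrow> nat \<Rightarrow> nat" where
  "prev X i = Max {y \<in> X. y < i}"

definition nxt :: "nat set \<Rightarrow> nat \<Rightarrow> nat" where
  "nxt X i = Min {y \<in> X. i < y}"

text \<open>The weight of the path through \<open>X\<close> that ends in \<open>v\<close>, summed
  over followers instead of edges so that it matches a trace. Inserting \<open>v\<close> closes the
  last gap.\<close>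

definition leader_cost :: "(nat \<Rightarrow> real) \<Rightarrow> nat set \<Rightarrow> nat \<Rightarrow> real" where
  "leader_cost g X v = (\<Sum>i\<in>{1..<v} - X. green g (Suc (prev X i)) (nxt (insert v X) i) i i)"

lemma prev_props:
  assumes "finite X" "x \<in> X" "x < i"
  shows "prev X i \<in> X" "prev X i < i" "\<And>y. y \<in> X \<Longrightarrow> y < i \<Longrightarrow> y \<le> prev X i"
proof -
  have "finite {y \<in> X. y < i}" "{y \<in> X. y < i} \<noteq> {}" using assms by auto
  from Max_in[OF this] Max_ge[OF this(1)]
  show "prev X i \<in> X" "prev X i < i" "\<And>y. y \<in> X \<Longrightarrow> y < i \<Longrightarrow> y \<le> prev X i"
    unfolding prev_def by auto
qed

lemma nxt_props:
  assumes "finite X" "x \<in> X" "i < x"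
  shows "nxt X i \<in> X" "i < nxt X i" "\<And>y. y \<in> X \<Longrightarrow> i < y \<Longrightarrow> nxt X i \<le> y"
proof -
  have "finite {y \<in> X. i < y}" "{y \<in> X. i < y} \<noteq> {}" using assms by auto
  from Min_in[OF this] Min_le[OF this(1)]
  show "nxt X i \<in> X" "i < nxt X i" "\<And>y. y \<in> X \<Longrightarrow> i < y \<Longrightarrow> nxt X i \<le> y"
    unfolding nxt_def by auto
qed

text \<open>Additivity along the edge from \<open>u\<close> to \<open>v\<close>: followers below
  \<open>u\<close> are shielded from \<open>v\<close> by \<open>u\<close> and keep their
  neighbouring leaders, while those above \<open>u\<close> fill exactly the gap between
  \<open>u\<close> and \<open>v\<close>.\<close>

lemma leader_cost_insert:
  assumes X: "X \<subseteq> {..<u}" "0 \<in> insert u X" and uv: "u < v"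
  shows "leader_cost g (insert u X) v = leader_cost g X u + block_trace g (Suc u) v"
proof -
  have fin: "finite X" using X(1) finite_subset by blast
  have split: "{1..<v} - insert u X = ({1..<u} - X) \<union> {Suc u..<v}"
    using X uv by auto
  have left: "prev (insert u X) i = prev X i \<and> nxt (insert v (insert u X)) i = nxt (insert u X) i"
    if "i \<in> {1..<u} - X" for i
  proof -
    let ?T = "{y \<in> insert u X. i < y}"
    have "{y \<in> insert u X. y < i} = {y \<in> X. y < i}" using that by auto
    moreover have "{y \<in> insert v (insert u X). i < y} = insert v ?T"
      using that uv by auto
    moreover have T: "finite ?T" "u \<in> ?T" using that fin by auto
    moreover have "Min (insert v ?T) = min v (Min ?T)"
      using T by (intro Min_insert) auto
    moreover have "Min ?T \<le> u" using T by (rule Min_le)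
    ultimately show ?thesis
      using uv by (simp only: prev_def nxt_def min_def) presburger
  qed
  have right: "prev (insert u X) i = u \<and> nxt (insert v (insert u X)) i = v"
    if "i \<in> {Suc u..<v}" for i
  proof -
    have "{y \<in> insert u X. y < i} = insert u X" using that X by auto
    moreover have "Max (insert u X) = u" using X fin by (intro Max_eqI) auto
    moreover have "{y \<in> insert v (insert u X). i < y} = {v}" using that X by auto
    ultimately show ?thesis by (simp add: prev_def nxt_def)
  qed
  have "leader_cost g (insert u X) v
      = (\<Sum>i\<in>{1..<u} - X. green g (Suc (prev (insert u X) i)) (nxt (insert v (insert u X)) i) i i)
      + (\<Sum>i\<in>{Suc u..<v}. green g (Suc (prev (insert u X) i)) (nxt (insert v (insert u X)) i) i i)"
    unfolding leader_cost_def split by (rule sum.union_disjoint) auto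
  also have "\<dots> = leader_cost g X u + block_trace g (Suc u) v"
    unfolding leader_cost_def block_trace_def using left right
    by (intro arg_cong2[of _ _ _ _ "(+)"] sum.cong) auto
  finally show ?thesis .
qed

lemma total_variance_leader_cost:
  assumes noise: "noise_params n \<nu>" and S: "S \<subseteq> {1..n}" "S \<noteq> {}"
  shows "total_variance n \<nu> S = 1 / 2 * leader_cost (link n \<nu>) (insert 0 S) (Suc n)"
proof -
  define g where "g = link n \<nu>"
  define lo where "lo j = Suc (prev (insert 0 S) j)" for j
  define hi where "hi j = nxt (insert (Suc n) (insert 0 S)) j" for j
  \<comment> \<open>The block-diagonal inverse, assembled by columns: column \<open>j\<close> is the
    Green column of the block containing \<open>j\<close>, extended by zero.\<close>
  define G where "G i j = (if lo j \<le> i \<and> i < hi j then green g (lo j) (hi j) i j else 0)" for i j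
  let ?F = "{1..n} - S"
  have fin: "finite S" using S finite_subset by blast
  have block: "1 \<le> lo j" "lo j \<le> j" "j < hi j" "hi j \<le> Suc n"
    "lo j - 1 \<notin> ?F" "hi j \<notin> ?F" "{lo j..<hi j} \<subseteq> ?F" if "j \<in> ?F" for j
  proof -
    note p = prev_props[of "insert 0 S" 0 j, folded lo_def]
    note q = nxt_props[of "insert (Suc n) (insert 0 S)" "Suc n" j, folded hi_def]
    show lj: "1 \<le> lo j" "lo j \<le> j" "j < hi j" "hi j \<le> Suc n"
      using p q fin that by (auto simp: lo_def Suc_le_eq)
    show "lo j - 1 \<notin> ?F" "hi j \<notin> ?F"
      using p q fin that by (auto simp: lo_def)
    have "y \<notin> S" if y: "lo j \<le> y" "y < hi j" for y
    proof
      assume "y \<in> S"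
      moreover have "y \<noteq> j" using \<open>y \<in> S\<close> \<open>j \<in> ?F\<close> by auto
      ultimately show False
        using p(3)[of y] q(3)[of y] fin y \<open>j \<in> ?F\<close> by (cases "y < j") (auto simp: lo_def)
    qed
    then show "{lo j..<hi j} \<subseteq> ?F" using lj by auto
  qed
  have nz: "minor g (lo j) (hi j) \<noteq> 0" if "j \<in> ?F" for j
  proof -
    \<comment> \<open>Here nonemptiness of \<open>S\<close> enters: a block reaching both ends would
      leave no leader.\<close>
    have "\<not> (lo j = 1 \<and> hi j = Suc n)" using block(7)[OF that] S by fastforce
    then show ?thesis
      using minor_link_pos[OF noise, of "lo j" "hi j"] block[OF that] by (auto simp: g_def)
  qed
  have "(\<Sum>l\<in>?F. lap_entry n \<nu> i l * G l j) = of_bool (i = j)" if i: "i \<in> ?F" and j: "j \<in> ?F" for i j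
  proof -
    note b = block[OF j]
    have "(\<Sum>l\<in>?F. lap_entry n \<nu> i l * G l j)
        = (\<Sum>l\<in>?F. (if l = i then (g (i - 1) + g i) * G l j else 0)
            - (if l = i - 1 then g (i - 1) * G l j else 0)
            - (if l = Suc i then g i * G l j else 0))"
      using i by (intro sum.cong) (auto simp: lap_entry_link[OF noise] g_def)
    also have "\<dots> = (g (i - 1) + g i) * G i j
        - (if i - 1 \<in> ?F then g (i - 1) * G (i - 1) j else 0)
        - (if Suc i \<in> ?F then g i * G (Suc i) j else 0)"
      using i by (simp add: sum_subtractf)
    also have "\<dots> = of_bool (i = j)"
    proof (cases "lo j \<le> i \<and> i < hi j")
      case True
      \<comment> \<open>A neighbour of \<open>i\<close> inside the block is a follower. One outside
        is absent from the sum, and there \<open>green\<close> vanishes by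
        \<open>green_boundary\<close>.\<close>
      have 1: "(if i - 1 \<in> ?F then g (i - 1) * G (i - 1) j else 0)
          = g (i - 1) * green g (lo j) (hi j) (i - 1) j"
      proof (cases "i = lo j")
        case True
        then show ?thesis using b(5) green_boundary(1)[OF b(1-3), of g] by auto
      next
        case False
        then have "i - 1 \<in> {lo j..<hi j}" using True by auto
        then show ?thesis using b(7) by (auto simp: G_def)
      qed
      have 2: "(if Suc i \<in> ?F then g i * G (Suc i) j else 0)
          = g i * green g (lo j) (hi j) (Suc i) j"
      proof (cases "Suc i = hi j")
        case True
        then show ?thesis using b(6) green_boundary(2)[OF b(1-3), of g] by auto
      next
        case False
        then have "Suc i \<in> {lo j..<hi j}" using True by auto
        then show ?thesis using b(7) by (auto simp: G_def)
      qed
      show ?thesis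
        unfolding 1 2 using green_column[OF b(1-3) _ _ nz[OF j], of i] True by (simp add: G_def)
    next
      case False
      then have "i \<noteq> j" using b by auto
      \<comment> \<open>The nodes bounding the block are not followers, so a follower outside the
        block has no neighbour inside it.\<close>
      have "i \<noteq> hi j" using b(6) i by blast
      moreover have "i \<noteq> lo j - 1" using b(5) i by blast
      ultimately have "G (Suc i) j = 0" "G (i - 1) j = 0" "G i j = 0"
        using False by (auto simp: G_def)
      with \<open>i \<noteq> j\<close> show ?thesis by simp
    qed
    finally show ?thesis .
  qed
  then have "total_variance n \<nu> S = 1 / 2 * (\<Sum>i\<in>?F. G i i)"
    by (rule total_variance_eqI)
  also have "(\<Sum>i\<in>?F. G i i) = leader_cost g (insert 0 S) (Suc n)"
    unfolding leader_cost_def using block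
    by (intro sum.cong) (auto simp: G_def lo_def hi_def)
  finally show ?thesis by (simp add: g_def)
qed

section \<open>The digraph\<close>

declare upt_Suc [simp del]

text \<open>The cost is ignored. Wrapping the predicate lets simplification run through
  straight-line code and stop at loops, where an invariant is supplied.\<close>

definition post :: "'a tm \<Rightarrow> ('a \<Rightarrow> bool) \<Rightarrow> bool" where
  "post m Q \<longleftrightarrow> Q (val m)"

lemma post_simps [simp]:
  "post (bind_tm m f) Q = post m (\<lambda>x. post (f x) Q)"
  "post (return x) Q = Q x"
  "post tick R = R ()"
  "post (add a b) Q1 = Q1 (a + b)"
  "post (sub a' b') Q2 = Q2 (a' - b')"
  "post (mul a'' b'') Q3 = Q3 (a'' * b'')"
  "post (quot y z) Q4 = Q4 (y / z)"
  "post (neg y) Q4 = Q4 (- y)"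
  "post (test_less l l') Q5 = Q5 (l < l')"
  "post (test_eq e e') Q5 = Q5 (e = e')"
  "post (alloc c x) Q6 = Q6 (\<lambda>_. x)"
  "post (rd h i) Q = Q (h i)"
  "post (wr h i x) Q6 = Q6 (h(i := x))"
  "post (cons x xs) Q7 = Q7 (x # xs)"
  by (simp_all add: post_def bind_tm_def return_def tick_def add_def sub_def mul_def quot_def
      neg_def test_less_def test_eq_def alloc_def rd_def wr_def cons_def)

lemma post_mono: "post m P \<Longrightarrow> (\<And>x. P x \<Longrightarrow> Q x) \<Longrightarrow> post m Q"
  by (simp add: post_def)

lemma post_if [simp]:
  "post (if b then m else m') Q = (if b then post m Q else post m' Q)"
  by simp

lemma post_improves [simp]:
  "post (improves tie x best) Q = Q (x < best \<or> x = best \<and> tie)"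
  by (auto simp: improves_def)

lemma post_for_each_upt:
  assumes "I a s" "a \<le> b"
    and step: "\<And>i s. a \<le> i \<Longrightarrow> i < b \<Longrightarrow> I i s \<Longrightarrow> post (body i s) (I (Suc i))"
    and fin: "\<And>s. I b s \<Longrightarrow> Q s"
  shows "post (for_each [a..<b] body s) Q"
proof -
  have "I b (val (for_each [a..<b] body s))"
    using assms(2,1) step
  proof (induction a arbitrary: s rule: inc_induct)
    case base
    then show ?case by (simp add: bind_tm_def tick_def return_def)
  next
    case (step a)
    then have "I b (val (for_each [Suc a..<b] body (val (body a s))))"
      by (simp add: post_def)
    then show ?case
      using step by (simp add: upt_conv_Cons bind_tm_def tick_def)
  qed
  then show ?thesis using fin by (simp add: post_def)
qed

lemma post_for_each_downt:
  assumes "I b s" "a \<le> b"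
    and step: "\<And>i s. a \<le> i \<Longrightarrow> i < b \<Longrightarrow> I (Suc i) s \<Longrightarrow> post (body i s) (I i)"
    and fin: "\<And>s. I a s \<Longrightarrow> Q s"
  shows "post (for_each (rev [a..<b]) body s) Q"
proof -
  have "I a (val (for_each (rev [a..<b]) body s))"
    using assms(2,1) step
  proof (induction b arbitrary: s rule: dec_induct)
    case base
    then show ?case by (simp add: bind_tm_def tick_def return_def)
  next
    case (step b)
    then have "I a (val (for_each (rev [a..<b]) body (val (body b s))))"
      by (simp add: post_def)
    then show ?case
      using step by (simp add: upt_Suc bind_tm_def tick_def)
  qed
  then show ?thesis using fin by (simp add: post_def)
qed

lemma post_form_laplacian:
  assumes "n \<ge> 1"
  shows "post (form_laplacian n (\<lambda>(i, j). 1 / \<nu> i j))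
    (\<lambda>A. \<forall>i. A (i, i) = link n \<nu> (i - 1) + link n \<nu> i \<and>
         A (i, Suc i) = - link n \<nu> i \<and> A (Suc i, i) = - link n \<nu> i)"
  unfolding form_laplacian_def
  apply simp
  \<comment> \<open>Before round \<open>b\<close> exactly the edges among the nodes up to
    \<open>b\<close> have been entered, so the array is the Laplacian of the path with
    \<open>b\<close> nodes.\<close>
  apply (rule post_for_each_upt[where I = "\<lambda>b A. \<forall>i. A (i, i) = link b \<nu> (i - 1) + link b \<nu> i \<and>
         A (i, Suc i) = - link b \<nu> i \<and> A (Suc i, i) = - link b \<nu> i"])
  using assms by (auto simp: link_def)

text \<open>The arrays hold \<open>minor g lo j\<close> and \<open>minor g j hi\<close>: these
  satisfy the recurrences of the two loops with the same starting values, and their products over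
  \<open>minor g lo hi\<close> are the diagonal entries of \<open>green\<close>.\<close>

lemma post_trace_inv_tridiag:
  assumes "1 \<le> lo"
    and A: "\<And>i. A (i, i) = g (i - 1) + g i" "\<And>i. A (i, Suc i) = - g i" "\<And>i. A (Suc i, i) = - g i"
  shows "post (trace_inv_tridiag A lo hi) (\<lambda>x. x = block_trace g lo hi)"
proof (cases "lo < hi")
  case False
  then show ?thesis by (simp add: trace_inv_tridiag_def block_trace_def)
next
  case True
  then obtain h where h: "hi = Suc h" "lo \<le> h" by (cases hi) auto
  have m1: "minor g lo (Suc lo) = g (lo - 1) + g lo"
    using minor_rec_right[OF assms(1) order_refl, of g] assms(1)
    by (simp add: minor_self) (simp add: minor_def)
  have m2: "minor g h hi = g (h - 1) + g h"
    using minor_rec_left[of h hi g] assms(1) h by (simp add: minor_self) (simp add: minor_def)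
  have rec_right: "minor g lo (Suc i) = A (i, i) * minor g lo i - A (i - 1, i) * A (i, i - 1) * minor g lo (i - 1)"
    if "Suc lo \<le> i" for i
    using minor_rec_right[OF assms(1), of i g] A(1)[of i] A(2,3)[of "i - 1"] that by simp
  have rec_left: "minor g i hi = A (i, i) * minor g (Suc i) hi
      - A (i, Suc i) * A (Suc i, i) * minor g (Suc (Suc i)) hi"
    if "lo \<le> i" "i < h" for i
    using minor_rec_left[of i hi g] A(1-3)[of i] that assms(1) h by simp
  have init_right: "\<forall>j. lo \<le> j \<and> j \<le> Suc lo \<longrightarrow>
      ((\<lambda>_. 0)(lo := 1, Suc lo := A (lo, lo))) j = minor g lo j"
  proof (intro allI impI)
    fix j assume "lo \<le> j \<and> j \<le> Suc lo"
    then have "j = lo \<or> j = Suc lo" by auto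
    then show "((\<lambda>_. 0)(lo := 1, Suc lo := A (lo, lo))) j = minor g lo j"
      using m1 A(1)[of lo] assms(1) by (auto simp: minor_self)
  qed
  have init_left: "\<forall>j. h \<le> j \<and> j \<le> hi \<longrightarrow>
      ((\<lambda>_. 0)(hi := 1, h := A (h, h))) j = minor g j hi"
  proof (intro allI impI)
    fix j assume "h \<le> j \<and> j \<le> hi"
    then have "j = h \<or> j = hi" using h by auto
    then show "((\<lambda>_. 0)(hi := 1, h := A (h, h))) j = minor g j hi"
      using m2 A(1)[of h] h by (auto simp: minor_self)
  qed
  show ?thesis
    unfolding trace_inv_tridiag_def
    using True apply (simp add: h(1) del: fun_upd_apply)
    unfolding h(1)[symmetric]
    apply (rule post_for_each_upt[where I = "\<lambda>i \<theta>. \<forall>j. lo \<le> j \<and> j \<le> i \<longrightarrow> \<theta> j = minor g lo j"])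
    subgoal by (rule init_right)
    subgoal using h by simp
    subgoal for i \<theta>
      using rec_right[of i] by (simp add: le_Suc_eq)
    subgoal for \<theta>
      apply (simp del: fun_upd_apply)
      apply (rule post_for_each_downt[where I = "\<lambda>i \<phi>. \<forall>j. i \<le> j \<and> j \<le> hi \<longrightarrow> \<phi> j = minor g j hi"])
      subgoal by (rule init_left)
      subgoal by (rule h(2))
      subgoal for i \<phi>
        using rec_left[of i] h by (auto simp: Suc_le_eq)
      subgoal for \<phi>
        apply (rule post_for_each_upt[where I = "\<lambda>i tr. tr = (\<Sum>j = lo..<i. green g lo hi j j)"])
        using h by (auto simp: green_def block_trace_def)
      done
    done
qed

text \<open>The excluded pair joins source and target; a path using it would select no
  leader.\<close>

definition edge :: "nat \<Rightarrow> nat \<Rightarrow> nat \<Rightarrow> bool" where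
  "edge n u v \<longleftrightarrow> u < v \<and> v \<le> Suc n \<and> \<not> (u = 0 \<and> v = Suc n)"

lemma post_build_digraph:
  assumes "n \<ge> 1"
  shows "post (build_digraph n (\<lambda>(i, j). 1 / \<nu> i j) 0 (Suc n))
    (\<lambda>W. W = (\<lambda>(u, v). if edge n u v then Some (block_trace (link n \<nu>) (Suc u) v) else None))"
proof -
  define c where "c u v = Some (block_trace (link n \<nu>) (Suc u) v)" for u v
  define M where "M R = (\<lambda>(u, v). if R u v then c u v else None)" for R :: "nat \<Rightarrow> nat \<Rightarrow> bool"
  have M0: "(\<lambda>_. None) = M (\<lambda>_ _. False)" by (auto simp: M_def)
  \<comment> \<open>\<open>R1\<close>, \<open>R2\<close>, \<open>R3\<close> are the edges entered so
    far during the three loops; \<open>R2\<close> grows lexicographically because its loop is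
    nested.\<close>
  define R1 where "R1 i a b \<longleftrightarrow> a = 0 \<and> 1 \<le> b \<and> b < i" for i a b :: nat
  define R2 where "R2 i j a b \<longleftrightarrow> R1 (Suc n) a b \<or> 1 \<le> a \<and> a < b \<and> b \<le> n \<and> (a < i \<or> a = i \<and> b < j)"
    for i j a b :: nat
  define R3 where "R3 i a b \<longleftrightarrow> R2 (Suc n) 0 a b \<or> 1 \<le> a \<and> a < i \<and> b = Suc n" for i a b :: nat
  have upd1: "(M (R1 i))((0, i) := c 0 i) = M (R1 (Suc i))" if "1 \<le> i" for i
    using that by (auto simp: M_def R1_def fun_eq_iff)
  have upd2: "(M (R2 i j))((i, j) := c i j) = M (R2 i (Suc j))" if "1 \<le> i" "i < j" "j \<le> n" for i j
    using that by (auto simp: M_def R2_def fun_eq_iff)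
  have upd3: "(M (R3 i))((i, Suc n) := c i (Suc n)) = M (R3 (Suc i))" if "1 \<le> i" for i
    using that by (auto simp: M_def R3_def fun_eq_iff)
  have R3: "R3 (Suc n) = edge n"
    by (auto simp: fun_eq_iff R3_def R2_def R1_def edge_def)
  show ?thesis
    unfolding build_digraph_def
    apply (simp add: M0)
    apply (rule post_mono[OF post_form_laplacian[OF assms, of \<nu>]])
    subgoal for A
    proof -
      assume A: "\<forall>i. A (i, i) = link n \<nu> (i - 1) + link n \<nu> i \<and>
         A (i, Suc i) = - link n \<nu> i \<and> A (Suc i, i) = - link n \<nu> i"
      have tr: "post (trace_inv_tridiag A (Suc u) v) (\<lambda>w. Q (Some w))" if "Q (c u v)" for u v Q
        using post_trace_inv_tridiag[of "Suc u" A "link n \<nu>" v] A that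
        by (simp add: post_def c_def)
      show ?thesis
        apply (rule post_for_each_upt[where I = "\<lambda>i W. W = M (R1 i)"])
        subgoal by (auto simp: R1_def M_def)
        subgoal by simp
        subgoal for i W
          using tr[of "\<lambda>w. W((0, i) := w) = M (R1 (Suc i))" 0 i]
          upd1[of i] by simp
        subgoal for W
          apply simp
          apply (rule post_for_each_upt[where I = "\<lambda>i W. W = M (R2 i 0)"])
          subgoal by (auto simp: R2_def M_def)
          subgoal by simp
          subgoal for i W'
            apply simp
            apply (rule post_for_each_upt[where I = "\<lambda>j W. W = M (R2 i j)"])
            subgoal by (auto simp: R2_def M_def fun_eq_iff)
            subgoal by simp
            subgoal for j W''
              using tr[of "\<lambda>w. W''((i, j) := w) = M (R2 i (Suc j))" i j]
              upd2[of i j] by simp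
            subgoal by (auto simp: R2_def M_def fun_eq_iff less_Suc_eq_le)
            done
          subgoal for W'
            apply simp
            apply (rule post_for_each_upt[where I = "\<lambda>i W. W = M (R3 i)"])
            subgoal by (auto simp: R3_def M_def)
            subgoal by simp
            subgoal for i W''
              using tr[of "\<lambda>w. W''((i, Suc n) := w) = M (R3 (Suc i))" i "Suc n"]
              upd3[of i] by simp
            subgoal by (simp add: R3 M_def c_def fun_eq_iff)
            done
          done
        done
    qed
    done
qed

section \<open>Shortest paths\<close>

text \<open>
  If no \<open>u\<close> is reachable then \<open>best = \<infinity>\<close>, and \<open>pred\<close> is arbitrary: a tie at \<open>\<infinity>\<close> may still
  overwrite it.
\<close>

definition relaxed ::
    "(nat \<times> nat \<Rightarrow> real option) \<Rightarrow> (nat \<Rightarrow> ereal) \<Rightarrow> nat \<Rightarrow> nat \<Rightarrow> ereal \<Rightarrow> nat \<Rightarrow> bool" where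
  "relaxed W f v i best pred \<longleftrightarrow>
     (\<forall>u<i. \<forall>w. W (u, v) = Some w \<longrightarrow> best \<le> f u + ereal w) \<and>
     (best = \<infinity> \<or> pred < i \<and> (\<exists>w. W (pred, v) = Some w \<and> best = f pred + ereal w))"

text \<open>The nodes met when following \<open>m\<close> predecessors back from \<open>v\<close>.
  Leaving out \<open>v\<close> itself makes this the set argument of
  \<open>leader_cost\<close>.\<close>

primrec chain :: "(nat \<times> nat \<Rightarrow> nat) \<Rightarrow> nat \<Rightarrow> nat \<Rightarrow> nat set" where
  "chain p 0 v = {}"
| "chain p (Suc m) v = insert (p (Suc m, v)) (chain p m (p (Suc m, v)))"

lemma relaxed_Suc:
  assumes "relaxed W f v i best pred"
    and upd: "upd \<longleftrightarrow> (case W (i, v) of None \<Rightarrow> False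
      | Some w \<Rightarrow> f i + ereal w < best \<or> f i + ereal w = best \<and> tie)"
  shows "relaxed W f v (Suc i) (if upd then f i + ereal (the (W (i, v))) else best)
    (if upd then i else pred)"
  using assms(1) unfolding upd
  by (auto simp: relaxed_def less_Suc_eq not_less split: option.splits
      intro: order.trans less_imp_le)

lemma post_relax_loop:
  "post (for_each [0..<N] (\<lambda>u (best, pred). do {
           e \<leftarrow> rd W (u, v);
           tick;
           case e of
             None \<Rightarrow> return (best, pred)
           | Some w \<Rightarrow> do {
               x \<leftarrow> rd d (m, u);
               y \<leftarrow> add x (ereal w);
               b \<leftarrow> improves (tie u) y best;
               return (if b then (y, u) else (best, pred))
             }
         }) (\<infinity>, s)) (\<lambda>(best, pred). relaxed W (\<lambda>u. d (m, u)) v N best pred)"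
proof (rule post_for_each_upt[where I = "\<lambda>i (best, pred). relaxed W (\<lambda>u. d (m, u)) v i best pred"])
  fix i :: nat and s :: "ereal \<times> nat"
  assume "case s of (best, pred) \<Rightarrow> relaxed W (\<lambda>u. d (m, u)) v i best pred"
  then show "post (case s of (best, pred) \<Rightarrow> do {
           e \<leftarrow> rd W (i, v);
           tick;
           case e of
             None \<Rightarrow> return (best, pred)
           | Some w \<Rightarrow> do {
               x \<leftarrow> rd d (m, i);
               y \<leftarrow> add x (ereal w);
               b \<leftarrow> improves (tie i) y best;
               return (if b then (y, i) else (best, pred))
             }
         }) (\<lambda>(best, pred). relaxed W (\<lambda>u. d (m, u)) v (Suc i) best pred)"
    using relaxed_Suc[of W "\<lambda>u. d (m, u)" v i "fst s" "snd s" _ "tie i", OF _ refl]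
    by (cases "W (i, v)") (auto split: prod.splits if_splits)
qed (auto simp: relaxed_def)

text \<open>Everything later proofs need from a run. \<open>M = 0\<close> is the default when no
  finite distance has been selected; the bound on \<open>length P\<close> serves the running
  time.\<close>

lemma post_bellman_ford:
  "post (bellman_ford tie_pred tie_len N W s t H) (\<lambda>(P, w). \<exists>d p M.
     (\<forall>v. d (0, v) = (if v = s then 0 else \<infinity>)) \<and>
     (\<forall>m<H. \<forall>v<N. relaxed W (\<lambda>u. d (m, u)) v N (d (Suc m, v)) (p (Suc m, v))) \<and>
     M \<le> H \<and> (\<forall>m. 1 \<le> m \<and> m \<le> H \<longrightarrow> w \<le> d (m, t)) \<and>
     (M = 0 \<and> w = \<infinity> \<or> 1 \<le> M \<and> w = d (M, t)) \<and>
     set P = insert t (chain p M t) \<and> length P = Suc M)"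
proof -
  define I where "I m j = (\<lambda>(d, p).
     (\<forall>v. d (0::nat, v) = (if v = s then 0 else \<infinity>)) \<and>
     (\<forall>m' v. v < N \<and> (Suc m' < m \<or> Suc m' = m \<and> v < j) \<longrightarrow>
        relaxed W (\<lambda>u. d (m', u)) v N (d (Suc m', v)) (p (Suc m', v))))" for m j :: nat
  have I_upd: "I m (Suc v) (d((m, v) := best), p((m, v) := pred))"
    if "I m v (d, p)" "relaxed W (\<lambda>u. d (m - 1, u)) v N best pred" "1 \<le> m" for m v d p best pred
  proof -
    \<comment> \<open>Row \<open>m\<close> is computed from row \<open>m - 1\<close> alone, so
      writing to it disturbs none of the rows read so far.\<close>
    have "(\<lambda>u. (d((m, v) := best)) (m', u)) = (\<lambda>u. d (m', u))" if "Suc m' \<le> m" for m'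
      using that by auto
    then show ?thesis
      using that unfolding I_def by (auto simp: less_Suc_eq)
  qed
  define J where "J d i = (\<lambda>(best, M).
     (\<forall>m. 1 \<le> m \<and> m < i \<longrightarrow> best \<le> d (m, t)) \<and>
     (M = 0 \<and> best = \<infinity> \<or> 1 \<le> M \<and> M < i \<and> best = d (M, t)))"
    for d :: "nat \<times> nat \<Rightarrow> ereal" and i :: nat
  define result where "result d p M = (\<lambda>(P, w).
     (\<forall>v. d (0, v) = (if v = s then 0 else \<infinity>)) \<and>
     (\<forall>m<H. \<forall>v<N. relaxed W (\<lambda>u. d (m, u)) v N (d (Suc m, v)) (p (Suc m, v))) \<and>
     M \<le> H \<and> (\<forall>m. 1 \<le> m \<and> m \<le> H \<longrightarrow> w \<le> d (m, t)) \<and>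
     (M = 0 \<and> w = \<infinity> \<or> 1 \<le> M \<and> w = d (M, t)) \<and>
     set P = insert t (chain p M t) \<and> length P = Suc M)" for d :: "nat \<times> nat \<Rightarrow> ereal" and p M
  define R where "R x \<longleftrightarrow> (\<exists>d p M. result d p M x)" for x
  have R_I: "R x" if "result d p M x" for d p M x
    using that by (auto simp: R_def)
  have "post (bellman_ford tie_pred tie_len N W s t H) R"
    unfolding bellman_ford_def
    apply simp
    apply (rule post_for_each_upt[where I = "\<lambda>m. I m 0"])
    subgoal by (auto simp: I_def)
    subgoal by simp
    subgoal for m s'
      apply (cases s')
      subgoal for d0 p0
        apply simp
        apply (rule post_for_each_upt[where I = "I m"])
        subgoal by simp
        subgoal by simp
        subgoal for v s''
          apply (cases s'')
          subgoal for d p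
            apply simp
            apply (rule post_mono[OF post_relax_loop])
            apply (auto simp: I_upd)
            done
          done
        subgoal by (auto simp: I_def less_Suc_eq)
        done
      done
    subgoal for s'
      apply (cases s')
      subgoal for d p
        apply simp
        apply (rule post_for_each_upt[where I = "J d"])
        subgoal by (auto simp: J_def)
        subgoal by simp
        subgoal for i s''
          by (cases s'') (auto simp: J_def less_Suc_eq intro: less_imp_le order.trans)
        subgoal for s''
          apply (cases s'')
          subgoal for w M
            apply simp
            \<comment> \<open>\<open>chain p (i - 1) v\<close> is the part still to be collected;
              the index is shifted because the counter \<open>i\<close> is one above the next
              round.\<close>
            apply (rule post_for_each_downt[where I = "\<lambda>i (P, v).
                set P \<union> chain p (i - 1) v = insert t (chain p M t) \<and> length P + i = M + 2"])
            subgoal by simp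
            subgoal by simp
            subgoal for i s3
              by (cases s3; cases i) auto
            subgoal for s3
              by (cases s3) (auto simp: I_def J_def result_def intro!: R_I[of d p M])
            done
          done
        done
      done
    done
  then show ?thesis by (simp only: post_def R_def result_def case_prod_beta)
qed

section \<open>Running time\<close>

lemma time_simps [simp]:
  "time (bind_tm m f) = time m + time (f (val m))"
  "time (return x) = 0"
  "time tick = 1"
  "time (add a b) = 1"
  "time (sub a' b') = 1"
  "time (mul a'' b'') = 1"
  "time (quot y z) = 1"
  "time (neg y) = 1"
  "time (test_less l l') = 1"
  "time (test_eq e e') = 1"
  "time (alloc c x) = Suc c"
  "time (rd h i) = 1"
  "time (wr h i x) = 1"
  "time (cons x xs) = 1"
  by (simp_all add: bind_tm_def return_def tick_def add_def sub_def mul_def quot_def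
      neg_def test_less_def test_eq_def alloc_def rd_def wr_def cons_def)

lemma time_for_each:
  assumes "\<And>i s. i \<in> set is \<Longrightarrow> time (body i s) \<le> T"
  shows "time (for_each is body s) \<le> 1 + length is * (2 + T)"
  using assms
proof (induction "is" arbitrary: s)
  case (Cons i "is")
  then have "time (body i s) \<le> T" "time (for_each is body (val (body i s))) \<le> 1 + length is * (2 + T)"
    by auto
  then show ?case by simp
qed simp

lemma val_arith [simp]:
  "val (add a b) = a + b" "val (sub a' b') = a' - b'" "val (mul a'' b'') = a'' * b''"
  by (simp_all add: add_def sub_def mul_def)

lemma time_if_le: "time m \<le> a \<Longrightarrow> time m' \<le> a' \<Longrightarrow> time (if b then m else m') \<le> max a a'"
  by (simp add: le_max_iff_disj)

lemma time_bind_le: "time m \<le> a \<Longrightarrow> time (f (val m)) \<le> b \<Longrightarrow> time (bind_tm m f) \<le> a + b"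
  by simp

lemma time_option_le:
  "time m \<le> a \<Longrightarrow> (\<And>w. x = Some w \<Longrightarrow> time (f w) \<le> b) \<Longrightarrow>
    time (case x of None \<Rightarrow> m | Some w \<Rightarrow> f w) \<le> max a b"
  by (cases x) (auto simp: le_max_iff_disj)

lemma time_prod_le:
  "(\<And>a b. x = (a, b) \<Longrightarrow> time (f a b) \<le> T) \<Longrightarrow> time (case x of (a, b) \<Rightarrow> f a b) \<le> T"
  by (cases x) auto

lemma time_prim_le:
  "time (return x) \<le> 0"
  "time tick \<le> 1"
  "time (add a b) \<le> 1"
  "time (sub a' b') \<le> 1"
  "time (mul a'' b'') \<le> 1"
  "time (quot y z) \<le> 1"
  "time (neg y) \<le> 1"
  "time (test_less l l') \<le> 1"
  "time (test_eq e e') \<le> 1"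
  "time (alloc c x) \<le> Suc c"
  "time (rd h i) \<le> 1"
  "time (wr h i x) \<le> 1"
  "time (cons x xs) \<le> 1"
  by simp_all

lemma time_improves_le: "time (improves tie x best) \<le> 2"
  by (simp add: improves_def)

text \<open>Applied after \<open>order.trans\<close>, these rules compute a bound into a schematic
  variable; only an arithmetic comparison then remains.\<close>

lemmas time_le = time_bind_le time_if_le time_option_le time_prod_le time_prim_le time_improves_le

lemma time_for_each_le:
  assumes "\<And>i s. i \<in> set is \<Longrightarrow> time (body i s) \<le> T" "length is \<le> l"
  shows "time (for_each is body s) \<le> 1 + l * (2 + T)"
  using time_for_each[of "is" body T s] mult_right_mono[OF assms(2), of "2 + T"] assms(1)
  by fastforce

lemma time_form_laplacian: "time (form_laplacian n g) \<le> 100 * (n + 1) * (n + 1)"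
  unfolding form_laplacian_def
  apply (rule order.trans)
   apply (rule time_le time_for_each_le[where l = n] | (simp; fail))+
  apply (simp add: algebra_simps)
  done

lemma time_trace_inv_tridiag:
  assumes "hi \<le> h"
  shows "time (trace_inv_tridiag A lo hi) \<le> 100 * (h + 1)"
  unfolding trace_inv_tridiag_def
  apply (rule order.trans)
   apply (rule time_le time_for_each_le[where l = h] | (use assms in \<open>simp; fail\<close>))+
  done

text \<open>Quadratically many edges, each costing one linear-time trace.\<close>

lemma time_build_digraph:
  assumes "n \<ge> 1"
  shows "time (build_digraph n g s t) \<le> 10000 * (n + 1) ^ 3"
  unfolding build_digraph_def
  apply (rule order.trans)
   apply (rule time_le time_form_laplacian time_trace_inv_tridiag[where h = "n + 1"]
      time_for_each_le[where l = n] | (auto; fail))+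
  apply (simp add: power3_eq_cube algebra_simps)
  done

text \<open>The traceback loop has \<open>M\<close> rounds with \<open>M\<close> computed at run
  time, so bounding its cost takes a fact about values.\<close>

lemma post_select_length:
  "post (for_each [1..<Suc H] (\<lambda>m (best, M). do {
       x \<leftarrow> rd d (m, t);
       b \<leftarrow> improves (tie_len m) x best;
       return (if b then (x, m) else (best, M))
     }) (\<infinity>, 0)) (\<lambda>(best, M). M \<le> H)"
  by (rule post_for_each_upt[where I = "\<lambda>i (best, M). M < i"]) (auto split: prod.splits)

lemma time_bellman_ford:
  "time (bellman_ford tie_pred tie_len N W s t H) \<le> 100 * (H + 1) * (N + 1) * (N + 1)"
  unfolding bellman_ford_def
  apply (rule order.trans)
   apply (rule time_le)+
     apply (rule time_for_each_le[where l = H])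
      apply (rule time_le)+
       apply (rule time_for_each_le[where l = N])
        apply (rule time_le)+
         apply (rule time_for_each_le[where l = N])
          apply (rule time_le)+
         apply (simp; fail)
        apply (rule time_le)+
       apply (simp; fail)
      apply (simp; fail)
     apply (rule time_le)+
     apply (rule time_for_each_le[where l = H])
      apply (rule time_le)+
     apply (simp; fail)
    apply (rule time_le)+
    apply (rule time_for_each_le[where l = H])
     apply (rule time_le)+
  subgoal for d p w M
    using post_select_length[of H d t tie_len] by (simp add: post_def)
   apply (rule time_le)+
  apply (simp add: algebra_simps)
  done

section \<open>Optimality\<close>

definition leader_graph :: "nat \<Rightarrow> (nat \<Rightarrow> real) \<Rightarrow> nat \<times> nat \<Rightarrow> real option" where
  "leader_graph n g = (\<lambda>(u, v). if edge n u v then Some (block_trace g (Suc u) v) else None)"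

lemma leader_cost_empty: "leader_cost g {} 0 = 0"
  by (simp add: leader_cost_def)

text \<open>Induction on the number of edges: the largest element of \<open>X\<close> is the last
  node before \<open>v\<close>, and removing it splits off one edge by
  \<open>leader_cost_insert\<close>. The condition \<open>X \<noteq> {0}\<close> at the target rules
  out the absent edge from the source.\<close>

lemma distance_le_leader_cost:
  assumes init: "d (0, 0) = (0::ereal)"
    and rec: "\<And>m v. m < H \<Longrightarrow> v < n + 2 \<Longrightarrow>
      relaxed (leader_graph n g) (\<lambda>u. d (m, u)) v (n + 2) (d (Suc m, v)) (p (Suc m, v))"
    and X: "X \<subseteq> {..<v}" "v = 0 \<or> 0 \<in> X" "v \<le> Suc n" "v = Suc n \<longrightarrow> X \<noteq> {0}" "card X = m" "m \<le> H"
  shows "d (m, v) \<le> ereal (leader_cost g X v)"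
  using X
proof (induction m arbitrary: X v)
  case 0
  then have "X = {}" using finite_subset[OF 0(1)] by auto
  then show ?case using 0 init by (auto simp: leader_cost_empty zero_ereal_def)
next
  case (Suc m)
  have fin: "finite X" using Suc.prems(1) finite_subset by blast
  have ne: "X \<noteq> {}" using Suc.prems(5) by auto
  define u where "u = Max X"
  have u: "u \<in> X" "\<And>x. x \<in> X \<Longrightarrow> x \<le> u" using fin ne by (auto simp: u_def)
  have uv: "u < v" and X0: "0 \<in> X" using u(1) Suc.prems(1,2) by auto
  let ?Y = "X - {u}"
  have Y: "?Y \<subseteq> {..<u}" "card ?Y = m" "insert u ?Y = X"
    using u fin Suc.prems(5) by (auto simp: le_less)
  have IH: "d (m, u) \<le> ereal (leader_cost g ?Y u)"
    using Y X0 uv Suc.prems(3,6) by (intro Suc.IH) auto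
  have "X = {0}" if "u = 0" using that u X0 by auto
  then have "edge n u v" using uv Suc.prems(3,4) by (auto simp: edge_def)
  then have "d (Suc m, v) \<le> d (m, u) + ereal (block_trace g (Suc u) v)"
    using rec[of m v] uv Suc.prems(3,6) by (auto simp: relaxed_def leader_graph_def)
  also have "\<dots> \<le> ereal (leader_cost g ?Y u) + ereal (block_trace g (Suc u) v)"
    using IH by (rule add_right_mono)
  also have "\<dots> = ereal (leader_cost g X v)"
    using leader_cost_insert[OF Y(1) _ uv, of g] X0 Y(3) by simp
  finally show ?case .
qed

text \<open>The converse bound. Finiteness selects the attained alternative of
  \<open>relaxed\<close>, and it passes to the predecessor because adding a real weight to
  \<open>\<infinity>\<close> gives \<open>\<infinity>\<close>.\<close>

lemma chain_leader_cost:
  assumes init: "\<And>v. d (0, v) = (if v = 0 then 0 else \<infinity> :: ereal)"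
    and rec: "\<And>m v. m < H \<Longrightarrow> v < n + 2 \<Longrightarrow>
      relaxed (leader_graph n g) (\<lambda>u. d (m, u)) v (n + 2) (d (Suc m, v)) (p (Suc m, v))"
    and "m \<le> H" "v \<le> Suc n" "d (m, v) \<noteq> \<infinity>"
  shows "chain p m v \<subseteq> {..<v} \<and> (v = 0 \<or> 0 \<in> chain p m v) \<and> (v = Suc n \<longrightarrow> chain p m v \<noteq> {0}) \<and>
    card (chain p m v) = m \<and> d (m, v) = ereal (leader_cost g (chain p m v) v)"
  using assms(3-)
proof (induction m arbitrary: v)
  case 0
  then show ?case using init[of v] by (auto simp: leader_cost_empty zero_ereal_def split: if_splits)
next
  case (Suc m)
  let ?u = "p (Suc m, v)"
  have e: "edge n ?u v" and d: "d (Suc m, v) = d (m, ?u) + ereal (block_trace g (Suc ?u) v)"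
    using rec[of m v] Suc.prems by (auto simp: relaxed_def leader_graph_def split: if_splits)
  have uv: "?u < v" using e by (simp add: edge_def)
  have "d (m, ?u) \<noteq> \<infinity>" using d Suc.prems(3) by auto
  then have IH: "chain p m ?u \<subseteq> {..<?u}" "?u = 0 \<or> 0 \<in> chain p m ?u" "card (chain p m ?u) = m"
    "d (m, ?u) = ereal (leader_cost g (chain p m ?u) ?u)"
    using Suc.IH[of ?u] Suc.prems uv by auto
  have "finite (chain p m ?u)" using IH(1) finite_subset by blast
  moreover have "?u \<notin> chain p m ?u" using IH(1) by auto
  ultimately have "card (chain p (Suc m) v) = Suc m" using IH(3) by simp
  moreover have "chain p (Suc m) v \<subseteq> {..<v}" using IH(1) uv by auto
  moreover have 0: "0 \<in> chain p (Suc m) v" using IH(2) by auto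
  moreover have "chain p (Suc m) v \<noteq> {0}" if "v = Suc n"
    using that e by (auto simp: edge_def)
  moreover have "d (Suc m, v) = ereal (leader_cost g (chain p (Suc m) v) v)"
    using d IH(4) leader_cost_insert[OF IH(1) _ uv, of g] 0 by simp
  ultimately show ?case by blast
qed

lemma set_for_each_filter:
  "set (val (for_each P (\<lambda>v S. do {
       a \<leftarrow> test_eq v s;
       b \<leftarrow> test_eq v t;
       if a \<or> b then return S else cons v S
     }) S)) = set S \<union> (set P - {s, t})"
  by (induction P arbitrary: S)
    (auto simp: bind_tm_def test_eq_def return_def cons_def tick_def)

lemma select_leaders_optimal:
  fixes k n \<nu>
  assumes n: "n \<ge> 1" and k: "k \<ge> 1" and noise: "noise_params n \<nu>"
  shows "post (select_leaders tie_pred tie_len n (\<lambda>(i, j). 1 / \<nu> i j) k) (\<lambda>(S, w).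
    set S \<noteq> {} \<and> set S \<subseteq> path_nodes n \<and> card (set S) \<le> k \<and>
    (\<forall>S'. S' \<noteq> {} \<and> S' \<subseteq> path_nodes n \<and> card S' \<le> k \<longrightarrow>
       total_variance n \<nu> (set S) \<le> total_variance n \<nu> S'))"
proof -
  define g where "g = link n \<nu>"
  define optimal where "optimal S \<longleftrightarrow> S \<noteq> {} \<and> S \<subseteq> {1..n} \<and> card S \<le> k \<and>
    (\<forall>S'. S' \<noteq> {} \<and> S' \<subseteq> {1..n} \<and> card S' \<le> k \<longrightarrow>
       total_variance n \<nu> S \<le> total_variance n \<nu> S')" for S
  have main: "optimal (set P - {0, Suc n})"
    if init: "\<forall>v. d (0, v) = (if v = 0 then 0 else \<infinity> :: ereal)"
    and rec: "\<forall>m<Suc k. \<forall>v<n + 2.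
      relaxed (leader_graph n g) (\<lambda>u. d (m, u)) v (n + 2) (d (Suc m, v)) (p (Suc m, v))"
    and w_le: "\<forall>m. 1 \<le> m \<and> m \<le> Suc k \<longrightarrow> w \<le> d (m, Suc n)"
    and w: "M = 0 \<and> w = \<infinity> \<or> 1 \<le> M \<and> w = d (M, Suc n)" and M: "M \<le> Suc k"
    and P: "set P = insert (Suc n) (chain p M (Suc n))" for d p w M P
  proof -
    have opt: "w \<le> ereal (2 * total_variance n \<nu> S')"
      if S': "S' \<noteq> {}" "S' \<subseteq> {1..n}" "card S' \<le> k" for S'
    proof -
      have fin: "finite S'" and "0 \<notin> S'" using S' finite_subset by auto
      then have card: "card (insert 0 S') = Suc (card S')" by simp
      have "w \<le> d (Suc (card S'), Suc n)" using w_le S'(3) by simp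
      also have "\<dots> \<le> ereal (leader_cost g (insert 0 S') (Suc n))"
        by (rule distance_le_leader_cost[where H = "Suc k" and n = n and p = p])
          (use init rec card S' \<open>0 \<notin> S'\<close> in \<open>auto simp: subset_iff\<close>)
      finally show ?thesis
        using total_variance_leader_cost[OF noise S'(2,1)] by (simp add: g_def mult.commute)
    qed
    \<comment> \<open>The single leader 1 is always admissible and has finite cost.\<close>
    have "w \<noteq> \<infinity>" using opt[of "{1}"] n k by auto
    then have wM: "w = d (M, Suc n)" using w by auto
    let ?X = "chain p M (Suc n)"
    have X: "?X \<subseteq> {..<Suc n}" "0 \<in> ?X" "?X \<noteq> {0}" "card ?X = M"
      "d (M, Suc n) = ereal (leader_cost g ?X (Suc n))"
      using chain_leader_cost[of d "Suc k" n g p M "Suc n"] init rec M \<open>w \<noteq> \<infinity>\<close> wM by auto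
    let ?S = "set P - {0, Suc n}"
    have S: "?S = ?X - {0}" using P X(1) by auto
    have XS: "insert 0 ?S = ?X" using S X(2) by auto
    have S_ne: "?S \<noteq> {}" using S X(2,3) by auto
    have S_sub: "?S \<subseteq> {1..n}" using S X(1) by (auto simp: less_Suc_eq_le)
    have "finite ?X" using X(1) finite_subset by blast
    \<comment> \<open>The chain contains the source, so at most \<open>k + 1\<close> nodes leave at
      most \<open>k\<close> leaders.\<close>
    then have S_card: "card ?S \<le> k" using S X(2,4) M by simp
    have "w = ereal (2 * total_variance n \<nu> ?S)"
      using total_variance_leader_cost[OF noise S_sub S_ne] XS wM X(5) by (simp add: g_def)
    then show ?thesis using opt S_ne S_sub S_card by (auto simp: optimal_def)
  qed
  have bf: "post (bellman_ford tie_pred tie_len (n + 2) (leader_graph n g) 0 (Suc n) (Suc k))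
     (\<lambda>(P, w). \<exists>d p M.
     (\<forall>v. d (0, v) = (if v = 0 then 0 else \<infinity>)) \<and>
     (\<forall>m<Suc k. \<forall>v<n + 2. relaxed (leader_graph n g) (\<lambda>u. d (m, u)) v (n + 2) (d (Suc m, v)) (p (Suc m, v))) \<and>
     M \<le> Suc k \<and> (\<forall>m. 1 \<le> m \<and> m \<le> Suc k \<longrightarrow> w \<le> d (m, Suc n)) \<and>
     (M = 0 \<and> w = \<infinity> \<or> 1 \<le> M \<and> w = d (M, Suc n)) \<and>
     set P = insert (Suc n) (chain p M (Suc n)) \<and> length P = Suc M)"
    by (rule post_bellman_ford)
  have bf': "post (bellman_ford tie_pred tie_len (n + 2) (leader_graph n g) 0 (Suc n) (Suc k))
     (\<lambda>(P, w). optimal (set P - {0, Suc n}))"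
    using bf
  proof (rule post_mono, goal_cases)
    case (1 x)
    obtain P w where x: "x = (P, w)" by (cases x)
    from 1 obtain d p M where
      "\<forall>v. d (0, v) = (if v = 0 then 0 else \<infinity> :: ereal)"
      "\<forall>m<Suc k. \<forall>v<n + 2.
        relaxed (leader_graph n g) (\<lambda>u. d (m, u)) v (n + 2) (d (Suc m, v)) (p (Suc m, v))"
      "\<forall>m. 1 \<le> m \<and> m \<le> Suc k \<longrightarrow> w \<le> d (m, Suc n)"
      "M = 0 \<and> w = \<infinity> \<or> 1 \<le> M \<and> w = d (M, Suc n)" "M \<le> Suc k"
      "set P = insert (Suc n) (chain p M (Suc n))"
      unfolding x prod.case by blast
    from main[OF this] show ?case unfolding x prod.case .
  qed
  have W: "post (build_digraph n (\<lambda>(i, j). 1 / \<nu> i j) 0 (Suc n)) (\<lambda>W. W = leader_graph n g)"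
    unfolding leader_graph_def g_def by (rule post_build_digraph[OF n])
  have "post (select_leaders tie_pred tie_len n (\<lambda>(i, j). 1 / \<nu> i j) k) (\<lambda>(S, w). optimal (set S))"
    unfolding select_leaders_def Let_def
    apply (simp add: split_beta)
    apply (rule post_mono[OF W])
    apply simp
    apply (rule post_mono[OF bf'[simplified]])
    apply (simp add: post_def set_for_each_filter split: prod.splits)
    done
  then show ?thesis by (simp only: optimal_def path_nodes_def)
qed

lemma time_select_leaders:
  assumes "1 \<le> n" "k \<le> n"
  shows "time (select_leaders tie_pred tie_len n g k) \<le> 100000 * n ^ 3"
proof -
  \<comment> \<open>The output loop runs over the path itself, whose length is known only from the
    specification of the routine.\<close>
  have len: "length P \<le> k + 2"
    if "val (bellman_ford tie_pred tie_len N W s t (k + 1)) = (P, w)" for N W s t P w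
    using post_bellman_ford[of tie_pred tie_len N W s t "k + 1"] that by (auto simp: post_def)
  have "time (select_leaders tie_pred tie_len n g k)
      \<le> 10000 * (n + 1) ^ 3 + 100 * (k + 2) * (n + 3) * (n + 3) + (4 + (k + 2) * 6)"
    unfolding select_leaders_def Let_def
    apply (rule order.trans)
     apply (rule time_le time_build_digraph[OF assms(1)] time_bellman_ford)+
      apply (rule time_for_each_le[where l = "k + 2"])
       apply (rule time_le)+
      apply (rule len, simp)
     apply (rule time_le)+
    apply (simp add: algebra_simps)
    done
  \<comment> \<open>By \<open>1 \<le> n\<close> and \<open>k \<le> n\<close>, the factors are at
    most \<open>2 * n\<close>, \<open>3 * n\<close> and \<open>4 * n\<close>. The coefficients
    finally total 84822, which is rounded up to 100000.\<close>
  also have "\<dots> \<le> 10000 * (2 * n) ^ 3 + 100 * (3 * n) * (4 * n) * (4 * n) + (4 + (k + 2) * 6)"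
    using assms by (intro add_mono mult_mono power_mono) auto
  also have "\<dots> \<le> 10000 * (2 * n) ^ 3 + 100 * (3 * n) * (4 * n) * (4 * n) + 22 * n ^ 3"
  proof -
    have "4 + (k + 2) * 6 \<le> 22 * n" using assms by simp
    also have "\<dots> \<le> 22 * n ^ 3" using assms by (simp add: self_le_power)
    finally show ?thesis by simp
  qed
  also have "\<dots> \<le> 100000 * n ^ 3" by (simp add: power3_eq_cube)
  finally show ?thesis .
qed

theorem theorem1:
  shows "(\<forall>n k (\<nu> :: nat \<Rightarrow> nat \<Rightarrow> real) tie_pred tie_len.
            n \<ge> 1 \<and> k \<ge> 1 \<and> noise_params n \<nu> \<longrightarrow>
            (let S = set (fst (val (select_leaders tie_pred tie_len n (\<lambda>(i, j). 1 / \<nu> i j) k))) in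
               S \<noteq> {} \<and> S \<subseteq> path_nodes n \<and> card S \<le> k \<and>
               (\<forall>S'. S' \<noteq> {} \<and> S' \<subseteq> path_nodes n \<and> card S' \<le> k \<longrightarrow>
                  total_variance n \<nu> S \<le> total_variance n \<nu> S')))
       \<and> (\<exists>C :: nat. \<forall>n k (\<nu> :: nat \<Rightarrow> nat \<Rightarrow> real) tie_pred tie_len.
            n \<ge> 1 \<and> 1 \<le> k \<and> k \<le> n \<and> noise_params n \<nu> \<longrightarrow>
            time (select_leaders tie_pred tie_len n (\<lambda>(i, j). 1 / \<nu> i j) k) \<le> C * n ^ 3)"
proof (intro conjI allI impI exI[of _ 100000])
  fix n k :: nat and \<nu> :: "nat \<Rightarrow> nat \<Rightarrow> real" and tie_pred tie_len
  assume "n \<ge> 1 \<and> k \<ge> 1 \<and> noise_params n \<nu>"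
  then show "let S = set (fst (val (select_leaders tie_pred tie_len n (\<lambda>(i, j). 1 / \<nu> i j) k))) in
               S \<noteq> {} \<and> S \<subseteq> path_nodes n \<and> card S \<le> k \<and>
               (\<forall>S'. S' \<noteq> {} \<and> S' \<subseteq> path_nodes n \<and> card S' \<le> k \<longrightarrow>
                  total_variance n \<nu> S \<le> total_variance n \<nu> S')"
    using select_leaders_optimal[of n k \<nu> tie_pred tie_len] unfolding post_def Let_def split_beta by simp
next
  fix n k :: nat and \<nu> :: "nat \<Rightarrow> nat \<Rightarrow> real" and tie_pred tie_len
  assume "n \<ge> 1 \<and> 1 \<le> k \<and> k \<le> n \<and> noise_params n \<nu>"
  then show "time (select_leaders tie_pred tie_len n (\<lambda>(i, j). 1 / \<nu> i j) k) \<le> 100000 * n ^ 3"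
    by (intro time_select_leaders) auto
qed

end
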